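(* Let $\mathcal{P}=\{f_\lambda:\lambda\in\Lambda\}$ be a family of probability distributions, and let $\mathcal{L_G}$ be the underlying generalized likelihood function. Let $T$ be a generalized complete sufficient statistic for $\mathcal{P}$. Then any generalized ancillary statistic $A$ for $\mathcal{P}$ is independent of $T$ (under the deformed distribution $\widetilde{P}_\lambda$, for every $\lambda\in\Lambda$).
   Context: Setting: $\mathcal{P}=\{f_\lambda:\lambda\in\Lambda\}$, $\Lambda\subseteq\mathbb{R}^k$ open, is a parametric family of probability densities; $Y_1^n=(Y_1,\dots,Y_n)$ is an i.i.d. sample from some $f_\lambda$, with values $y_1^n\in S^n\subseteq\mathbb{R}^n$. A generalized likelihood function is a real-valued function $\mathcal{L_G}(y_1^n;\lambda)$ of the sample and the parameter (used in place of the log-likelihood). Deformed distribution: $\widetilde{f}_\lambda(y_1^n)=\dfrac{\exp[\mathcal{L_G}(y_1^n;\lambda)]}{\int \exp[\mathcal{L_G}(r_1^n;\lambda)]\,dr_1^n}$, where the denominator is assumed finite. $\widetilde{P}_\lambda,\widetilde{E}_\lambda$ denote probability and expectation when $Y_1^n$ has density $\widetilde{f}_\lambda$. A statistic $T$ (possibly vector valued) is generalized sufficient for $\mathcal{P}$ if $\mathcal{L_G}(r_1^n;\lambda)-\mathcal{L_G}(s_1^n;\lambda)$ is independent of $\lambda$ whenever $T(r_1^n)=T(s_1^n)$. $T$ is generalized complete for $\mathcal{P}$ if for every function $h$, $\widetilde{E}_\lambda[h(T)]=0$ for all $\lambda\in\Lambda$ implies $\widetilde{P}_\lambda\{h(T)=0\}=1$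 for all $\lambda\in\Lambda$. A generalized complete sufficient statistic is both generalized sufficient and generalized complete. A statistic $A(Y_1^n)$ is generalized ancillary for $\mathcal{P}$ if, for every $a$, $\widetilde{P}_\lambda\{A(Y_1^n)\le a\}=\int_{\{y_1^n:A(y_1^n)\le a\}}\widetilde f_\lambda(y_1^n)\,dy_1^n$ is independent of $\lambda$. *)

theory Defs
  imports "HOL-Probability.Probability"
begin

text \<open>
  Samples of size \<open>n\<close> are vectors of type \<open>real ^ 'n\<close>, where \<open>'n\<close> is an arbitrary finite index type
  with \<open>n\<close> elements. The sample space \<open>S\<close>-to-the-\<open>n\<close> carries Lebesgue measure on its Borel sets;
  likelihoods and statistics matter only on this set.
\<close>

definition sample_space :: "real set \<Rightarrow> (real ^ 'n) measure" where
  "sample_space S = restrict_space lborel {y. \<forall>i. y $ i \<in> S}"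

definition density_family :: "real set \<Rightarrow> (real ^ 'k) set \<Rightarrow> (real ^ 'k \<Rightarrow> real \<Rightarrow> real) \<Rightarrow> bool" where
  "density_family S \<Lambda> f \<longleftrightarrow>
     S \<in> sets borel \<and> open \<Lambda> \<and>
     (\<forall>\<theta>\<in>\<Lambda>. (\<forall>x\<in>S. 0 \<le> f \<theta> x) \<and> has_bochner_integral (restrict_space lborel S) (f \<theta>) 1)"

text \<open>
  A generalized likelihood function is an arbitrary real-valued function \<open>L y \<theta>\<close> of the sample and
  the parameter; the only requirement is that the normalising integral of \<open>exp L\<close> exists and is
  finite, which includes measurability of \<open>L\<close> in the sample.
\<close>

definition generalized_likelihood ::
  "real set \<Rightarrow> (real ^ 'k) set \<Rightarrow> (real ^ 'n \<Rightarrow> real ^ 'k \<Rightarrow> real) \<Rightarrow> bool" where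
  "generalized_likelihood S \<Lambda> L \<longleftrightarrow>
     (\<forall>\<theta>\<in>\<Lambda>. integrable (sample_space S) (\<lambda>r. exp (L r \<theta>)))"

definition deformed_density ::
  "real set \<Rightarrow> (real ^ 'n \<Rightarrow> real ^ 'k \<Rightarrow> real) \<Rightarrow> real ^ 'k \<Rightarrow> real ^ 'n \<Rightarrow> real" where
  "deformed_density S L \<theta> y = exp (L y \<theta>) / (\<integral>r. exp (L r \<theta>) \<partial>sample_space S)"

definition deformed_measure ::
  "real set \<Rightarrow> (real ^ 'n \<Rightarrow> real ^ 'k \<Rightarrow> real) \<Rightarrow> real ^ 'k \<Rightarrow> (real ^ 'n) measure" where
  "deformed_measure S L \<theta> = density (sample_space S) (\<lambda>y. ennreal (deformed_density S L \<theta> y))"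

definition statistic :: "real set \<Rightarrow> (real ^ 'n \<Rightarrow> 'b::euclidean_space) \<Rightarrow> bool" where
  "statistic S T \<longleftrightarrow> T \<in> borel_measurable (sample_space S)"

definition generalized_sufficient ::
  "real set \<Rightarrow> (real ^ 'k) set \<Rightarrow> (real ^ 'n \<Rightarrow> real ^ 'k \<Rightarrow> real) \<Rightarrow>
   (real ^ 'n \<Rightarrow> 'b::euclidean_space) \<Rightarrow> bool" where
  "generalized_sufficient S \<Lambda> L T \<longleftrightarrow>
     statistic S T \<and>
     (\<forall>r\<in>space (sample_space S). \<forall>s\<in>space (sample_space S). T r = T s \<longrightarrow>
        (\<forall>\<theta>\<in>\<Lambda>. \<forall>\<eta>\<in>\<Lambda>. L r \<theta> - L s \<theta> = L r \<eta> - L s \<eta>))"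

text \<open>
  The Bochner integral of a non-integrable function is \<open>0\<close> by convention, so the existence of the
  expectation of \<open>h(T)\<close> has to be required explicitly. As integrability contains measurability of
  \<open>h(T)\<close>, the quantifier is over every function \<open>h\<close> for which \<open>h(T)\<close> is a random variable with an
  expectation. By Blackwell's theorem on Borel maps between standard Borel spaces, every such
  \<open>h(T)\<close> coincides with \<open>g(T)\<close> for some Borel function \<open>g\<close>, so that quantifying over Borel
  functions \<open>h\<close> would give the same notion.
\<close>

definition generalized_complete ::
  "real set \<Rightarrow> (real ^ 'k) set \<Rightarrow> (real ^ 'n \<Rightarrow> real ^ 'k \<Rightarrow> real) \<Rightarrow>
   (real ^ 'n \<Rightarrow> 'b::euclidean_space) \<Rightarrow> bool" where
  "generalized_complete S \<Lambda> L T \<longleftrightarrow>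
     statistic S T \<and>
     (\<forall>h :: 'b \<Rightarrow> real.
        (\<forall>\<theta>\<in>\<Lambda>. integrable (deformed_measure S L \<theta>) (\<lambda>y. h (T y)) \<and>
               (\<integral>y. h (T y) \<partial>deformed_measure S L \<theta>) = 0) \<longrightarrow>
        (\<forall>\<theta>\<in>\<Lambda>. measure (deformed_measure S L \<theta>)
                 {y \<in> space (deformed_measure S L \<theta>). h (T y) = 0} = 1))"

definition generalized_complete_sufficient ::
  "real set \<Rightarrow> (real ^ 'k) set \<Rightarrow> (real ^ 'n \<Rightarrow> real ^ 'k \<Rightarrow> real) \<Rightarrow>
   (real ^ 'n \<Rightarrow> 'b::euclidean_space) \<Rightarrow> bool" where
  "generalized_complete_sufficient S \<Lambda> L T \<longleftrightarrow>
     generalized_sufficient S \<Lambda> L T \<and> generalized_complete S \<Lambda> L T"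

text \<open>
  For a vector-valued statistic the order is the componentwise one, as the class
  \<^class>\<open>ordered_euclidean_space\<close> demands; \<open>'b = real\<close> is the scalar case.
\<close>

definition generalized_ancillary ::
  "real set \<Rightarrow> (real ^ 'k) set \<Rightarrow> (real ^ 'n \<Rightarrow> real ^ 'k \<Rightarrow> real) \<Rightarrow>
   (real ^ 'n \<Rightarrow> 'b::ordered_euclidean_space) \<Rightarrow> bool" where
  "generalized_ancillary S \<Lambda> L A \<longleftrightarrow>
     statistic S A \<and>
     (\<forall>a. \<forall>\<theta>\<in>\<Lambda>. \<forall>\<eta>\<in>\<Lambda>.
        measure (deformed_measure S L \<theta>) {y \<in> space (deformed_measure S L \<theta>). A y \<le> a} =
        measure (deformed_measure S L \<eta>) {y \<in> space (deformed_measure S L \<eta>). A y \<le> a})"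

text \<open>
  The library's \<open>indep_var\<close> needs both variables to have the same type, whereas the types of \<open>A\<close>
  and \<open>T\<close> are unrelated here; this is its defining condition (\<open>indep_vars_def2\<close>) at two types,
  without the measurability of \<open>X\<close> and \<open>Y\<close>, which is part of being a statistic.
\<close>

definition independent_rvs ::
  "'a measure \<Rightarrow> ('a \<Rightarrow> 'b::topological_space) \<Rightarrow> ('a \<Rightarrow> 'c::topological_space) \<Rightarrow> bool" where
  "independent_rvs M X Y \<longleftrightarrow>
     prob_space.indep_set M
       {X -` B \<inter> space M | B. B \<in> sets borel}
       {Y -` C \<inter> space M | C. C \<in> sets borel}"

end

theory Submission imports Defs begin

text \<open>
  This is Basu's argument. By sufficiency, the density ratio of two deformed distributions is constant
  on the fibres of \<open>T\<close>. Hence a version \<open>\<phi>\<close> of the conditional probability of \<open>A \<in> C\<close> given \<open>T\<close> under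
  one parameter has expectation \<open>P(A \<in> C)\<close> under every parameter, and this value is the same constant
  \<open>p\<close> for all of them by ancillarity. Completeness, applied to \<open>\<phi> - p\<close>, yields \<open>\<phi> = p\<close> almost surely.

  The conditioning is on the \<open>\<sigma>\<close>-algebra of all measurable sets that are unions of fibres of \<open>T\<close>,
  not on the one generated by \<open>T\<close>: fibrewise constant measurable functions are trivially measurable
  for the former, so no appeal to Blackwell's theorem is needed.
\<close>

section \<open>Measure-theoretic tools: the fibre \<sigma>-algebra, Basu's argument for abstract
  weights, and uniqueness from lower orthants\<close>

definition fibre_algebra :: "'a measure \<Rightarrow> ('a \<Rightarrow> 'b) \<Rightarrow> 'a measure" where
  "fibre_algebra M T = sigma (space M)
     {B \<in> sets M. \<forall>x\<in>space M. \<forall>y\<in>space M. T x = T y \<longrightarrow> (x \<in> B \<longleftrightarrow> y \<in> B)}"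

lemma space_fibre_algebra [simp]: "space (fibre_algebra M T) = space M"
  by (simp add: fibre_algebra_def space_measure_of_conv)

text \<open>The generating family is already a \<sigma>-algebra: agreement of membership along
  fibres passes to complements and countable unions.\<close>

lemma sets_fibre_algebra:
  "sets (fibre_algebra M T) =
     {B \<in> sets M. \<forall>x\<in>space M. \<forall>y\<in>space M. T x = T y \<longrightarrow> (x \<in> B \<longleftrightarrow> y \<in> B)}"
    (is "_ = ?F")
proof -
  have "sigma_algebra (space M) ?F"
    unfolding sigma_algebra_iff2 using sets.sets_into_space by blast
  then show ?thesis
    unfolding fibre_algebra_def by (rule sigma_algebra.sets_measure_of_eq)
qed

lemma subalgebra_fibre_algebra: "subalgebra M (fibre_algebra M T)"
  unfolding subalgebra_def sets_fibre_algebra space_fibre_algebra by blast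

lemma vimage_in_fibre_algebra:
  assumes "T \<in> measurable M N" "B \<in> sets N"
  shows "T -` B \<inter> space M \<in> sets (fibre_algebra M T)"
  using measurable_sets[OF assms] by (simp add: sets_fibre_algebra)

lemma measurable_fibre_algebraI:
  fixes g :: "'a \<Rightarrow> real"
  assumes "g \<in> borel_measurable M"
    and "\<And>x y. x \<in> space M \<Longrightarrow> y \<in> space M \<Longrightarrow> T x = T y \<Longrightarrow> g x = g y"
  shows "g \<in> borel_measurable (fibre_algebra M T)"
proof (rule measurableI)
  fix B :: "real set" assume "B \<in> sets borel"
  then have "g -` B \<inter> space M \<in> sets M"
    by (rule measurable_sets[OF assms(1)])
  moreover have "x \<in> g -` B \<inter> space M \<longleftrightarrow> y \<in> g -` B \<inter> space M"
    if "x \<in> space M" "y \<in> space M" "T x = T y" for x y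
    using that assms(2)[OF that] by simp
  ultimately show "g -` B \<inter> space (fibre_algebra M T) \<in> sets (fibre_algebra M T)"
    unfolding sets_fibre_algebra space_fibre_algebra by blast
qed simp

text \<open>The level set of \<open>g\<close> through \<open>x\<close> is a union of fibres, so it
  contains the representative that \<open>inv_into\<close> picks in the fibre of \<open>x\<close>.
  Evaluating \<open>g\<close> at representatives thus gives \<open>h\<close>. Nothing makes
  \<open>h\<close> Borel, which is harmless because completeness only asks that \<open>h(T)\<close>
  be integrable.\<close>

lemma measurable_fibre_algebra_factor:
  fixes g :: "'a \<Rightarrow> real"
  assumes "g \<in> borel_measurable (fibre_algebra M T)"
  shows "\<exists>h. \<forall>x\<in>space M. g x = h (T x)"
proof (intro exI[of _ "g \<circ> inv_into (space M) T"] ballI)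
  fix x assume x: "x \<in> space M"
  define y where "y = inv_into (space M) T (T x)"
  have y: "y \<in> space M" "T y = T x"
    unfolding y_def using inv_into_into[OF imageI[OF x]] f_inv_into_f[OF imageI[OF x]] by this
  have "g -` {g x} \<inter> space M \<in> sets (fibre_algebra M T)"
    using measurable_sets[OF assms, of "{g x}"] by simp
  then have "x \<in> g -` {g x} \<longleftrightarrow> y \<in> g -` {g x}"
    using x y unfolding sets_fibre_algebra by blast
  then have "g y = g x"
    by simp
  then show "g x = (g \<circ> inv_into (space M) T) (T x)"
    unfolding y_def comp_apply by (rule sym)
qed

text \<open>Here \<open>M\<close> stands for the law at a fixed reference parameter and
  \<open>w i\<close> for the density of the law at parameter \<open>i\<close> relative to it.
  Expectations under all parameters become weighted integrals over \<open>M\<close>, so a single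
  conditional expectation serves them all.\<close>

lemma (in prob_space) basu_event:
  fixes w :: "'i \<Rightarrow> 'a \<Rightarrow> real" and T :: "'a \<Rightarrow> 'b"
  assumes w_int: "\<And>i. i \<in> I \<Longrightarrow> integrable M (w i)"
    and w_one: "\<And>i. i \<in> I \<Longrightarrow> (\<integral>x. w i x \<partial>M) = 1"
    and w_fibre: "\<And>i x y. i \<in> I \<Longrightarrow> x \<in> space M \<Longrightarrow> y \<in> space M \<Longrightarrow> T x = T y \<Longrightarrow> w i x = w i y"
    and E: "E \<in> events"
    and ancillary: "\<And>i. i \<in> I \<Longrightarrow> (\<integral>x. w i x * indicator E x \<partial>M) = prob E"
    and complete: "\<And>h :: 'b \<Rightarrow> real.
        (\<And>i. i \<in> I \<Longrightarrow> integrable M (\<lambda>x. w i x * h (T x)) \<and> (\<integral>x. w i x * h (T x) \<partial>M) = 0) \<Longrightarrow>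
        AE x in M. h (T x) = 0"
    and B: "B \<in> sets (fibre_algebra M T)"
  shows "prob (E \<inter> B) = prob E * prob B"
proof -
  let ?F = "fibre_algebra M T"
  interpret finite_measure_subalgebra M ?F
    by unfold_locales (rule subalgebra_fibre_algebra)
  define \<phi> where "\<phi> = real_cond_exp M ?F (indicator E)"
  have BM: "B \<in> events"
    using B unfolding sets_fibre_algebra by blast
  \<comment> \<open>The characteristic property of conditional expectation. The test function
    \<open>g\<close> will be \<open>w i\<close> to check the hypothesis of completeness, and the
    indicator of \<open>B\<close> to conclude.\<close>
  have \<phi>: "integrable M (\<lambda>x. g x * \<phi> x)" "(\<integral>x. g x * \<phi> x \<partial>M) = (\<integral>x. g x * indicator E x \<partial>M)"
    if "integrable M g" "g \<in> borel_measurable ?F" for g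
    unfolding \<phi>_def using real_cond_exp_intg[OF integrable_real_mult_indicator[OF E that(1)] that(2)
      borel_measurable_indicator[OF E]] by this
  have "(\<lambda>x. \<phi> x - prob E) \<in> borel_measurable ?F"
    unfolding \<phi>_def by (intro borel_measurable_diff borel_measurable_cond_exp borel_measurable_const)
  from measurable_fibre_algebra_factor[OF this]
  obtain h where h: "\<forall>x\<in>space M. \<phi> x - prob E = h (T x)" ..
  have "AE x in M. h (T x) = 0"
  proof (rule complete[of h])
    fix i assume i: "i \<in> I"
    have "w i \<in> borel_measurable ?F"
      using borel_measurable_integrable[OF w_int[OF i]] w_fibre[OF i]
      by (rule measurable_fibre_algebraI)
    note int = \<phi>[OF w_int[OF i] this]
    have eq: "w i x * h (T x) = w i x * \<phi> x - w i x * prob E" if "x \<in> space M" for x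
      by (simp add: bspec[OF h that, symmetric] right_diff_distrib)
    have "integrable M (\<lambda>x. w i x * \<phi> x - w i x * prob E)"
      using int w_int[OF i] by auto
    moreover have "(\<integral>x. w i x * \<phi> x - w i x * prob E \<partial>M) = 0"
      using int w_int[OF i] by (simp add: w_one[OF i] ancillary[OF i])
    ultimately show "integrable M (\<lambda>x. w i x * h (T x)) \<and> (\<integral>x. w i x * h (T x) \<partial>M) = 0"
      by (simp add: eq cong: Bochner_Integration.integrable_cong Bochner_Integration.integral_cong)
  qed
  then have AE: "AE x in M. \<phi> x = prob E"
    using AE_space by eventually_elim (use h in fastforce)
  have "prob (E \<inter> B) = (\<integral>x. indicator B x * indicator E x \<partial>M)"
    using E BM by (simp add: indicator_inter_arith[symmetric] Int_commute)
  also have "\<dots> = (\<integral>x. indicator B x * \<phi> x \<partial>M)"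
    using \<phi>(2)[OF _ borel_measurable_indicator[OF B]] BM by (simp add: less_top[symmetric])
  also have "\<dots> = (\<integral>x. indicator B x * prob E \<partial>M)"
    using AE B BM E by (intro integral_cong_AE) (auto simp: \<phi>_def)
  also have "\<dots> = prob E * prob B"
    using BM by simp
  finally show ?thesis .
qed

text \<open>Lower orthants are stable under intersection and generate the Borel sets. Ancillarity
  gives information on these sets only.\<close>

lemma measure_eqI_atMost:
  fixes M N :: "'a::ordered_euclidean_space measure"
  assumes sets: "sets M = sets borel" "sets N = sets borel"
    and "finite_measure M"
    and eq: "\<And>a. emeasure M {..a} = emeasure N {..a}"
  shows "M = N"
proof (rule measure_eqI_generator_eq[where E = "range atMost" and \<Omega> = UNIV
      and A = "\<lambda>n. {..real n *\<^sub>R (\<Sum>Basis)}"])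
  have "{..a} \<inter> {..b} = {..inf a b}" for a b :: 'a
    by auto
  then show "Int_stable (range (atMost :: 'a \<Rightarrow> _))"
    by (auto simp: Int_stable_def)
  show "sets M = sigma_sets UNIV (range atMost)" "sets N = sigma_sets UNIV (range atMost)"
    by (simp_all add: sets borel_eq_atMost)
  \<comment> \<open>The orthants with corners on the diagonal exhaust the space, since the norm
    bounds every coordinate.\<close>
  have "\<exists>n::nat. x \<le> real n *\<^sub>R (\<Sum>Basis)" for x :: 'a
  proof -
    obtain n :: nat where "norm x \<le> real n"
      using real_arch_simple by blast
    then have "x \<bullet> i \<le> real n" if "i \<in> Basis" for i
      using Basis_le_norm[OF that, of x] by linarith
    then show ?thesis
      by (auto simp: eucl_le[where 'a='a])
  qed
  then show "(\<Union>n. {..real n *\<^sub>R (\<Sum>Basis) :: 'a}) = UNIV"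
    by auto
  show "emeasure M {..real n *\<^sub>R (\<Sum>Basis)} \<noteq> \<infinity>" for n
    using finite_measure.emeasure_finite[OF \<open>finite_measure M\<close>] by simp
  show "emeasure M X = emeasure N X" if "X \<in> range atMost" for X
    using that eq by blast
qed auto

section \<open>Deformed measures: positivity, change of parameter, and the effect of sufficiency and
  ancillarity\<close>

lemma space_deformed_measure [simp]: "space (deformed_measure S L \<theta>) = space (sample_space S)"
  by (simp add: deformed_measure_def)

lemma sets_deformed_measure [simp, measurable_cong]:
  "sets (deformed_measure S L \<theta>) = sets (sample_space S)"
  by (simp add: deformed_measure_def)

lemma deformed_density_measurable:
  assumes "generalized_likelihood S \<Lambda> L" "\<theta> \<in> \<Lambda>"
  shows "deformed_density S L \<theta> \<in> borel_measurable (sample_space S)"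
  using assms unfolding generalized_likelihood_def deformed_density_def
  by (auto intro!: borel_measurable_divide)

text \<open>
  If the sample space is a null set, the deformed measure is \<open>0\<close>; completeness for \<open>h = 0\<close> excludes
  this case.
\<close>

lemma generalized_complete_imp_prob_space:
  assumes "generalized_complete S \<Lambda> L T" "\<theta> \<in> \<Lambda>"
  shows "prob_space (deformed_measure S L \<theta>)"
proof -
  have "\<forall>\<theta>\<in>\<Lambda>. measure (deformed_measure S L \<theta>) (space (deformed_measure S L \<theta>)) = 1"
    using assms(1) unfolding generalized_complete_def by (auto dest!: spec[of _ "\<lambda>_. 0"])
  then have "measure (deformed_measure S L \<theta>) (space (deformed_measure S L \<theta>)) = 1"
    using assms(2) by blast
  \<comment> \<open>An infinite total mass would have \<open>measure\<close> equal to 0 by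
    convention, so the value 1 determines \<open>emeasure\<close> as well.\<close>
  then show ?thesis
    by (intro prob_spaceI, cases "emeasure (deformed_measure S L \<theta>) (space (deformed_measure S L \<theta>))"
        rule: ennreal_cases) (auto simp: measure_def)
qed

lemma deformed_density_pos:
  assumes "prob_space (deformed_measure S L \<theta>)"
  shows "0 < deformed_density S L \<theta> y"
proof -
  interpret prob_space "deformed_measure S L \<theta>" by fact
  let ?c = "\<integral>r. exp (L r \<theta>) \<partial>sample_space S"
  have "?c \<noteq> 0"
  proof
    \<comment> \<open>Division by zero yields 0, so the density would vanish identically and the
      total mass would be 0.\<close>
    assume "?c = 0"
    then have "deformed_measure S L \<theta> = density (sample_space S) (\<lambda>_. 0)"
      unfolding deformed_measure_def deformed_density_def by simp
    then show False
      using emeasure_space_1 by (simp add: emeasure_density)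
  qed
  moreover have "0 \<le> ?c"
    by (simp add: Bochner_Integration.integral_nonneg)
  ultimately show ?thesis
    by (simp add: deformed_density_def less_le)
qed

text \<open>Positivity of the density at \<open>\<theta>\<close> lets it cancel in the product of
  densities. This supplies the weights for \<open>basu_event\<close>.\<close>

lemma deformed_measure_change:
  assumes lik: "generalized_likelihood S \<Lambda> L" and "\<theta> \<in> \<Lambda>" "\<eta> \<in> \<Lambda>"
    and "prob_space (deformed_measure S L \<theta>)" "prob_space (deformed_measure S L \<eta>)"
  shows "deformed_measure S L \<eta> = density (deformed_measure S L \<theta>)
    (\<lambda>y. ennreal (deformed_density S L \<eta> y / deformed_density S L \<theta> y))"
proof -
  note [measurable] = deformed_density_measurable[OF lik \<open>\<theta> \<in> \<Lambda>\<close>]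
    deformed_density_measurable[OF lik \<open>\<eta> \<in> \<Lambda>\<close>]
  have pos: "0 < deformed_density S L \<theta> y" "0 < deformed_density S L \<eta> y" for y
    using assms deformed_density_pos by blast+
  have "ennreal (deformed_density S L \<theta> y) *
        ennreal (deformed_density S L \<eta> y / deformed_density S L \<theta> y) =
      ennreal (deformed_density S L \<eta> y)" for y
    using pos[of y] by (simp add: ennreal_mult[symmetric])
  then show ?thesis
    unfolding deformed_measure_def by (subst density_density_eq) auto
qed

lemma deformed_density_ratio_fibre:
  assumes "generalized_sufficient S \<Lambda> L T" "\<theta> \<in> \<Lambda>" "\<eta> \<in> \<Lambda>"
    and "x \<in> space (sample_space S)" "y \<in> space (sample_space S)" "T x = T y"
  shows "deformed_density S L \<eta> x / deformed_density S L \<theta> x =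
    deformed_density S L \<eta> y / deformed_density S L \<theta> y"
proof -
  have "L x \<theta> - L y \<theta> = L x \<eta> - L y \<eta>"
    using assms unfolding generalized_sufficient_def by blast
  \<comment> \<open>Sufficiency compares two samples at each parameter; rearranged, it compares two
    parameters at each sample, which is the logarithm of the density ratio up to normalising
    constants.\<close>
  then have "L x \<eta> - L x \<theta> = L y \<eta> - L y \<theta>"
    by simp
  moreover have "deformed_density S L \<eta> z / deformed_density S L \<theta> z = exp (L z \<eta> - L z \<theta>) *
      ((\<integral>r. exp (L r \<theta>) \<partial>sample_space S) / (\<integral>r. exp (L r \<eta>) \<partial>sample_space S))" for z
    by (simp add: deformed_density_def exp_diff)
  ultimately show ?thesis
    by simp
qed

text \<open>The two laws of \<open>A\<close> agree on lower orthants, hence on all Borel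
  sets.\<close>

lemma generalized_ancillary_measure_eq:
  fixes A :: "real ^ 'n \<Rightarrow> 'c::ordered_euclidean_space"
  assumes anc: "generalized_ancillary S \<Lambda> L A" and "\<theta> \<in> \<Lambda>" "\<eta> \<in> \<Lambda>"
    and prob: "prob_space (deformed_measure S L \<theta>)" "prob_space (deformed_measure S L \<eta>)"
    and C: "C \<in> sets borel"
  shows "measure (deformed_measure S L \<theta>) (A -` C \<inter> space (sample_space S)) =
    measure (deformed_measure S L \<eta>) (A -` C \<inter> space (sample_space S))"
proof -
  let ?P = "deformed_measure S L"
  interpret P: prob_space "?P \<theta>" by fact
  interpret Q: prob_space "?P \<eta>" by fact
  have [measurable]: "A \<in> borel_measurable (sample_space S)"
    using anc by (simp add: generalized_ancillary_def statistic_def)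
  have "distr (?P \<theta>) borel A = distr (?P \<eta>) borel A"
  proof (rule measure_eqI_atMost)
    show "finite_measure (distr (?P \<theta>) borel A)"
      by (intro P.finite_measure_distr) simp
    fix a
    have "measure (?P \<theta>) {y \<in> space (?P \<theta>). A y \<le> a} = measure (?P \<eta>) {y \<in> space (?P \<eta>). A y \<le> a}"
      using anc \<open>\<theta> \<in> \<Lambda>\<close> \<open>\<eta> \<in> \<Lambda>\<close> unfolding generalized_ancillary_def by blast
    moreover have "A -` {..a} \<inter> space (sample_space S) = {y \<in> space (sample_space S). A y \<le> a}"
      by auto
    ultimately show "emeasure (distr (?P \<theta>) borel A) {..a} = emeasure (distr (?P \<eta>) borel A) {..a}"
      by (simp add: emeasure_distr P.emeasure_eq_measure Q.emeasure_eq_measure)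
  qed simp_all
  then have "measure (distr (?P \<theta>) borel A) C = measure (distr (?P \<eta>) borel A) C"
    by simp
  then show ?thesis
    using C by (simp add: measure_distr)
qed

section \<open>Basu's theorem for the deformed family\<close>

theorem theorem3p3:
  fixes S :: "real set"
    and \<Lambda> :: "(real ^ 'k) set"
    and f :: "real ^ 'k \<Rightarrow> real \<Rightarrow> real"
    and L :: "real ^ 'n \<Rightarrow> real ^ 'k \<Rightarrow> real"
    and T :: "real ^ 'n \<Rightarrow> 'b::euclidean_space"
    and A :: "real ^ 'n \<Rightarrow> 'c::ordered_euclidean_space"
  assumes "density_family S \<Lambda> f"
    and "generalized_likelihood S \<Lambda> L"
    and "generalized_complete_sufficient S \<Lambda> L T"
    and "generalized_ancillary S \<Lambda> L A"
  shows "\<forall>\<theta>\<in>\<Lambda>. independent_rvs (deformed_measure S L \<theta>) A T"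
proof
  fix \<theta> assume \<theta>: "\<theta> \<in> \<Lambda>"
  let ?P = "deformed_measure S L"
  define w where "w \<eta> y = deformed_density S L \<eta> y / deformed_density S L \<theta> y" for \<eta> y
  have suff: "generalized_sufficient S \<Lambda> L T" and compl: "generalized_complete S \<Lambda> L T"
    using assms(3) by (simp_all add: generalized_complete_sufficient_def)
  have T [measurable]: "T \<in> borel_measurable (sample_space S)"
    using compl by (simp add: generalized_complete_def statistic_def)
  have A [measurable]: "A \<in> borel_measurable (sample_space S)"
    using assms(4) by (simp add: generalized_ancillary_def statistic_def)
  have prob: "prob_space (?P \<eta>)" if "\<eta> \<in> \<Lambda>" for \<eta>
    using generalized_complete_imp_prob_space[OF compl that] .
  have w_nonneg: "0 \<le> w \<eta> y" if "\<eta> \<in> \<Lambda>" for \<eta> y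
    using deformed_density_pos[OF prob[OF that]] deformed_density_pos[OF prob[OF \<theta>]]
    by (simp add: w_def less_imp_le)
  have w_measurable: "w \<eta> \<in> borel_measurable (?P \<theta>)" if "\<eta> \<in> \<Lambda>" for \<eta>
    using deformed_density_measurable[OF assms(2)] that \<theta> unfolding w_def by simp
  have change: "?P \<eta> = density (?P \<theta>) (\<lambda>y. ennreal (w \<eta> y))" if "\<eta> \<in> \<Lambda>" for \<eta>
    using deformed_measure_change[OF assms(2) \<theta> that prob[OF \<theta>] prob[OF that]] by (simp add: w_def)
  have integrable_iff: "integrable (?P \<eta>) g \<longleftrightarrow> integrable (?P \<theta>) (\<lambda>y. w \<eta> y * g y)"
    and integral_eq: "(\<integral>y. g y \<partial>?P \<eta>) = (\<integral>y. w \<eta> y * g y \<partial>?P \<theta>)"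
    if "\<eta> \<in> \<Lambda>" "g \<in> borel_measurable (sample_space S)" for \<eta> and g :: "real ^ 'n \<Rightarrow> real"
    using that w_nonneg[OF that(1)] w_measurable[OF that(1)]
    by (simp_all add: change[OF that(1)] integrable_density integral_density)
  interpret prob_space "?P \<theta>" by (rule prob[OF \<theta>])
  \<comment> \<open>Independence is obtained from the whole fibre \<sigma>-algebra, which contains
    all preimages of Borel sets under \<open>T\<close>.\<close>
  have indep: "prob (A -` C \<inter> space (?P \<theta>) \<inter> B) = prob (A -` C \<inter> space (?P \<theta>)) * prob B"
    if C: "C \<in> sets borel" and B: "B \<in> sets (fibre_algebra (?P \<theta>) T)" for B C
  proof (rule basu_event[where I = \<Lambda> and w = w and T = T])
    show "B \<in> sets (fibre_algebra (?P \<theta>) T)"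
      by (rule B)
    show E: "A -` C \<inter> space (?P \<theta>) \<in> events"
      using C by simp
    fix \<eta> assume \<eta>: "\<eta> \<in> \<Lambda>"
    interpret Q: prob_space "?P \<eta>" by (rule prob[OF \<eta>])
    show "integrable (?P \<theta>) (w \<eta>)"
      using integrable_iff[OF \<eta>, of "\<lambda>_. 1"] by simp
    show "(\<integral>x. w \<eta> x \<partial>?P \<theta>) = 1"
      using integral_eq[OF \<eta>, of "\<lambda>_. 1"] Q.prob_space by simp
    show "w \<eta> x = w \<eta> y"
      if "x \<in> space (?P \<theta>)" "y \<in> space (?P \<theta>)" "T x = T y" for x y
      unfolding w_def using that by (intro deformed_density_ratio_fibre[OF suff \<theta> \<eta>]) simp_all
    have "(\<integral>x. w \<eta> x * indicator (A -` C \<inter> space (?P \<theta>)) x \<partial>?P \<theta>) =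
        measure (?P \<eta>) (A -` C \<inter> space (?P \<theta>))"
      using integral_eq[OF \<eta>, of "indicator (A -` C \<inter> space (?P \<theta>))"] E by simp
    then show "(\<integral>x. w \<eta> x * indicator (A -` C \<inter> space (?P \<theta>)) x \<partial>?P \<theta>) =
        prob (A -` C \<inter> space (?P \<theta>))"
      using generalized_ancillary_measure_eq[OF assms(4) \<theta> \<eta> prob[OF \<theta>] prob[OF \<eta>] C] by simp
  next
    fix h :: "'b \<Rightarrow> real"
    assume h: "\<And>\<eta>. \<eta> \<in> \<Lambda> \<Longrightarrow> integrable (?P \<theta>) (\<lambda>x. w \<eta> x * h (T x)) \<and>
        (\<integral>x. w \<eta> x * h (T x) \<partial>?P \<theta>) = 0"
    \<comment> \<open>At the reference parameter the weight is 1, so integrability there already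
      makes \<open>h(T)\<close> measurable, as the transfer to the other parameters
      requires.\<close>
    have "(\<lambda>x. w \<theta> x * h (T x)) \<in> borel_measurable (sample_space S)"
      using h[OF \<theta>] by (auto dest: borel_measurable_integrable)
    moreover have "w \<theta> x = 1" for x
      using deformed_density_pos[OF prob[OF \<theta>], of x] by (simp add: w_def)
    ultimately have hT: "(\<lambda>x. h (T x)) \<in> borel_measurable (sample_space S)"
      by simp
    then have "\<forall>\<eta>\<in>\<Lambda>. integrable (?P \<eta>) (\<lambda>x. h (T x)) \<and> (\<integral>x. h (T x) \<partial>?P \<eta>) = 0"
      using h integrable_iff integral_eq by simp
    then have "prob {y \<in> space (?P \<theta>). h (T y) = 0} = 1"
      using compl \<theta> unfolding generalized_complete_def by blast
    then show "AE x in ?P \<theta>. h (T x) = 0"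
      using hT by (subst (asm) prob_Collect_eq_1) auto
  qed
  show "independent_rvs (?P \<theta>) A T"
    unfolding independent_rvs_def
  proof (rule indep_setI)
    show "{A -` B \<inter> space (?P \<theta>) |B. B \<in> sets borel} \<subseteq> events"
      "{T -` C \<inter> space (?P \<theta>) |C. C \<in> sets borel} \<subseteq> events"
      by auto
    have "T \<in> borel_measurable (?P \<theta>)"
      by simp
    note vimage_in_fibre_algebra[OF this]
    then show "prob (a \<inter> b) = prob a * prob b"
      if "a \<in> {A -` B \<inter> space (?P \<theta>) |B. B \<in> sets borel}"
        "b \<in> {T -` C \<inter> space (?P \<theta>) |C. C \<in> sets borel}" for a b
      using that indep by blast
  qed
qed

end
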